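(* Let $F_n$, $n\ge 2$, be a free group on $n$ generators, let $(X_n,d_n)$ be the associated space of pointed trees with the ball metric, and let $\mathfrak{M}_n$ be the suspension of the natural pseudogroup action of $\Gamma_n$ on $(X_n,d_n)$ (all defined in the context). Then for every $r\ge 1$, the lamination $\mathfrak{M}_n$ cannot be embedded as a foliated subset of a $C^\infty$-manifold with a $C^{\infty,r}$-foliation of any codimension by a bi-Lipschitz homeomorphism onto its image.
   Context: Cayley graph. $F_n$ is the free group on $n\ge 2$ generators with identity $e$, and $F_n^{1+}$ is a (non-symmetric) set of $n$ free generators, so $h\in F_n^{1+}$ implies $h^{-1}\notin F_n^{1+}$. The Cayley graph $\mathcal{G}_n$ has vertex set $F_n$, and for every $g\in F_n$ and $h\in F_n^{1+}$ an oriented edge labelled $h$ from $g$ to $gh$. It is a tree in which every vertex has valence $2n$; every edge has length $1$. Space of pointed trees. $X_n$ is the set of all connected non-compact (i.e. infinite) subgraphs $T\subset\mathcal{G}_n$ containing the vertex $e$; $V(T)\subset F_n$ is the vertex set of $T$. Two pointed subgraphs $(T,g_1)$ and $(T',g_2)$ of $\mathcal{G}_n$ are $F_n^{1+}$-isomorphic if there is an isometry $T\to T'$ mapping $g_1$ to $g_2$ and preserving orientations and labels of edges. For $T\in X_n$ and an integer $r\ge 0$, $B_T(e,r)$ is the closed ball of radius $r$ about $e$ in $T$. For $T\neq T'$ in $X_n$ put $d_n(T,T')=e^{-r(T,T')}$, where $r(T,T')$ is the maximal integer $r\ge 0$ such that there is an $F_n^{1+}$-isomorphism $(B_T(e,r),e)\to(B_{T'}(e,r),e)$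 (here $e^{-r}$ is the exponential); put $d_n(T,T)=0$. This is an ultrametric (the ball metric), and $(X_n,d_n)$ is a Cantor set. Pseudogroup. For $g\in F_n$ and $T\in X_n$ with $g\in V(T)$, $T\cdot g$ is the unique $T'\in X_n$ such that $(T,g)$ and $(T',e)$ are $F_n^{1+}$-isomorphic (equivalently $T'=g^{-1}T$). The map $\gamma_g:T\mapsto T\cdot g$ is a homeomorphism from the clopen set $\{T\in X_n:g\in V(T)\}$ onto its image, and $\Gamma_n=\{\gamma_g\}_{g\in F_n}$, generated by the $\gamma_g$ with $g\in F_n^{1+}$. Suspension. The suspension $\mathfrak{M}_n$ of $(X_n,d_n,\Gamma_n)$ (constructed by Ghys) is a compact metric space $(\mathfrak{M}_n,d_{\mathfrak{M}})$ with a finite smooth foliated atlas $\{\phi_i:V_i\to U_i\times\mathfrak{X}_i\}_{1\le i\le\nu}$, where $U_i\subset\mathbb{R}^2$ is open and $\mathfrak{X}_i$ is a Cantor set, with associated holonomy pseudogroup $\mathfrak{P}$, such that: (i) the leaves of $\mathfrak{M}_n$ are Riemann surfaces; (ii) there is a homeomorphism onto its image $t:X_n\to\bigcup_{1\le i\le\nu}\mathfrak{X}_i$ such that $t(X_n)$ is a transverse model for the foliation of $\mathfrak{M}_n$ by leaves (a clopen subset of the transversal meeting every leaf), and $\mathfrak{P}|_{t(X_n)}=t_*\Gamma_n$, the pseudogroup induced on $t(X_n)$ by $\Gamma_n$. Here the $\mathfrak{X}_i$ are identified with disjoint local transversals in $\mathfrak{M}_n$, and the metric $d_{\mathfrak{M}}$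 is compatible with $d_n$, in the sense that $t$, viewed as a map $X_n\to\mathfrak{M}_n$, is bi-Lipschitz onto its image with respect to $d_n$ and $d_{\mathfrak{M}}$. Foliations and embeddings. A $C^{\infty,r}$-foliation of a finite-dimensional $C^\infty$-manifold $M$ is a foliation whose leaves are smooth manifolds and which admits a foliated atlas of class $C^r$. $M$ carries the distance $d_M$ induced by a Riemannian metric. An embedding of $\mathfrak{M}_n$ as a foliated subset of $M$ is a homeomorphism $\varphi:\mathfrak{M}_n\to\varphi(\mathfrak{M}_n)\subset M$ onto a closed saturated subset (a closed union of leaves of the foliation of $M$), mapping leaves of $\mathfrak{M}_n$ onto leaves of the foliation. It is bi-Lipschitz if there is $K>0$ with $\frac1K d_{\mathfrak{M}}(x,y)\le d_M(\varphi(x),\varphi(y))\le K\,d_{\mathfrak{M}}(x,y)$ for all $x,y\in\mathfrak{M}_n$. *)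

theory Defs
  imports "HOL-Analysis.Analysis" "HOL-Algebra.Group"
begin

section \<open>The free group and its Cayley graph\<close>

text \<open>
  The free group of rank \<open>n\<close> is the group of reduced words in the letters \<open>(i, s)\<close>, \<open>i < n\<close>;
  the letter \<open>(i, True)\<close> is the \<open>i\<close>-th free generator and \<open>(i, False)\<close> is its inverse.
\<close>

type_synonym letter = "nat \<times> bool"
type_synonym word = "letter list"

definition inv_letter :: "letter \<Rightarrow> letter" where
  "inv_letter x = (fst x, \<not> snd x)"

fun reduced_word :: "word \<Rightarrow> bool" where
  "reduced_word (x # y # w) \<longleftrightarrow> y \<noteq> inv_letter x \<and> reduced_word (y # w)"
| "reduced_word _ \<longleftrightarrow> True"

fun red_cons :: "letter \<Rightarrow> word \<Rightarrow> word" where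
  "red_cons x [] = [x]"
| "red_cons x (y # w) = (if y = inv_letter x then w else x # y # w)"

definition free_group :: "nat \<Rightarrow> word monoid" where
  "free_group n = \<lparr>carrier = {w. fst ` set w \<subseteq> {..<n} \<and> reduced_word w},
     mult = (\<lambda>u v. foldr red_cons u v), one = []\<rparr>"

definition free_gens :: "nat \<Rightarrow> word set" where
  "free_gens n = {[(i, True)] | i. i < n}"

lemma inv_letter_invol [simp]: "inv_letter (inv_letter x) = x"
  by (simp add: inv_letter_def)

lemma reduced_tl: "reduced_word (x # w) \<Longrightarrow> reduced_word w"
  by (cases w) auto

lemma reduced_red_cons: "reduced_word w \<Longrightarrow> reduced_word (red_cons x w)"
  by (cases w) (auto dest: reduced_tl)

lemma reduced_foldr: "reduced_word v \<Longrightarrow> reduced_word (foldr red_cons u v)"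
  by (induction u) (auto intro: reduced_red_cons)

lemma red_cons_cancel: "reduced_word w \<Longrightarrow> red_cons x (red_cons (inv_letter x) w) = w"
proof (cases w)
  case (Cons y v)
  assume "reduced_word w"
  with Cons show ?thesis by (cases v) auto
qed auto

lemma letters_foldr: "set (foldr red_cons u v) \<subseteq> set u \<union> set v"
proof (induction u)
  case (Cons x u)
  then show ?case by (cases "foldr red_cons u v") auto
qed auto

lemma foldr_red_cons_assoc:
  assumes "reduced_word w"
  shows "foldr red_cons (foldr red_cons u v) w = foldr red_cons u (foldr red_cons v w)"
proof (induction u)
  case (Cons x u)
  note IH = this
  have "foldr red_cons (red_cons x z) w = red_cons x (foldr red_cons z w)" for z
  proof (cases "\<exists>m. z = inv_letter x # m")
    case True
    then obtain m where z: "z = inv_letter x # m" by blast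
    have "red_cons x (red_cons (inv_letter x) (foldr red_cons m w)) = foldr red_cons m w"
      by (intro red_cons_cancel reduced_foldr assms)
    then show ?thesis by (simp add: z)
  next
    case False
    then have "red_cons x z = x # z" by (cases z) auto
    then show ?thesis by simp
  qed
  then show ?case by (simp add: IH)
qed simp

lemma foldr_red_cons_Nil: "reduced_word u \<Longrightarrow> foldr red_cons u [] = u"
proof (induction u)
  case (Cons x u)
  then show ?case by (cases u) (auto dest: reduced_tl)
qed auto

lemma foldr_inv_word:
  "reduced_word w \<Longrightarrow> foldr red_cons (map inv_letter (rev u)) (foldr red_cons u w) = w"
proof (induction u arbitrary: w)
  case (Cons x u)
  have "red_cons (inv_letter x) (red_cons x (foldr red_cons u w)) = foldr red_cons u w"
    using red_cons_cancel[of "foldr red_cons u w" "inv_letter x"] Cons.prems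
    by (simp add: reduced_foldr)
  with Cons show ?case by simp
qed auto

lemma group_free_group: "group (free_group n)"
proof (rule groupI)
  fix u v w
  assume u: "u \<in> carrier (free_group n)" and v: "v \<in> carrier (free_group n)"
  show "u \<otimes>\<^bsub>free_group n\<^esub> v \<in> carrier (free_group n)"
  proof -
    have "fst ` set (foldr red_cons u v) \<subseteq> fst ` (set u \<union> set v)"
      by (rule image_mono) (rule letters_foldr)
    also have "\<dots> \<subseteq> {..<n}"
      using u v by (simp add: free_group_def image_Un)
    finally show ?thesis
      using v by (simp add: free_group_def reduced_foldr)
  qed
  assume "w \<in> carrier (free_group n)"
  then show "u \<otimes>\<^bsub>free_group n\<^esub> v \<otimes>\<^bsub>free_group n\<^esub> w
      = u \<otimes>\<^bsub>free_group n\<^esub> (v \<otimes>\<^bsub>free_group n\<^esub> w)"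
    by (simp add: free_group_def foldr_red_cons_assoc)
next
  fix u
  assume u: "u \<in> carrier (free_group n)"
  show "\<exists>y\<in>carrier (free_group n). y \<otimes>\<^bsub>free_group n\<^esub> u = \<one>\<^bsub>free_group n\<^esub>"
  proof
    let ?y = "foldr red_cons (map inv_letter (rev u)) []"
    have "set ?y \<subseteq> inv_letter ` set u"
      using letters_foldr[of "map inv_letter (rev u)" "[]"] by simp
    then have "fst ` set ?y \<subseteq> fst ` inv_letter ` set u"
      by (rule image_mono)
    also have "\<dots> = fst ` set u"
      by (simp add: image_image inv_letter_def)
    also have "\<dots> \<subseteq> {..<n}"
      using u by (simp add: free_group_def)
    finally have "fst ` set ?y \<subseteq> {..<n}" .
    then show "?y \<in> carrier (free_group n)"
      by (simp add: free_group_def reduced_foldr)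
    have "foldr red_cons ?y u = foldr red_cons (map inv_letter (rev u)) (foldr red_cons [] u)"
      using u by (intro foldr_red_cons_assoc) (simp add: free_group_def)
    also have "\<dots> = foldr red_cons (map inv_letter (rev u)) (foldr red_cons u [])"
      using u by (simp add: free_group_def foldr_red_cons_Nil)
    also have "\<dots> = []" by (rule foldr_inv_word) simp
    finally show "?y \<otimes>\<^bsub>free_group n\<^esub> u = \<one>\<^bsub>free_group n\<^esub>"
      by (simp add: free_group_def)
  qed
qed (simp_all add: free_group_def)


section \<open>The space of pointed trees\<close>

text \<open>
  An edge \<open>(g, h)\<close> is the oriented edge labelled \<open>h\<close> from \<open>g\<close> to \<open>g \<otimes> h\<close>.
\<close>

record cgraph =
  verts :: "word set"
  edges :: "(word \<times> word) set"

definition cayley :: "nat \<Rightarrow> cgraph" where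
  "cayley n = \<lparr>verts = carrier (free_group n), edges = carrier (free_group n) \<times> free_gens n\<rparr>"

definition subgraph :: "nat \<Rightarrow> cgraph \<Rightarrow> bool" where
  "subgraph n T \<longleftrightarrow> verts T \<subseteq> verts (cayley n) \<and> edges T \<subseteq> edges (cayley n) \<and>
     (\<forall>(g, h)\<in>edges T. g \<in> verts T \<and> g \<otimes>\<^bsub>free_group n\<^esub> h \<in> verts T)"

definition adj :: "nat \<Rightarrow> cgraph \<Rightarrow> word rel" where
  "adj n T = {(a, b). \<exists>(g, h)\<in>edges T. (a = g \<and> b = g \<otimes>\<^bsub>free_group n\<^esub> h) \<or>
                                       (b = g \<and> a = g \<otimes>\<^bsub>free_group n\<^esub> h)}"

definition connected_graph :: "nat \<Rightarrow> cgraph \<Rightarrow> bool" where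
  "connected_graph n T \<longleftrightarrow> (\<forall>a\<in>verts T. \<forall>b\<in>verts T. (a, b) \<in> (adj n T)\<^sup>*)"

definition gdist :: "nat \<Rightarrow> cgraph \<Rightarrow> word \<Rightarrow> word \<Rightarrow> nat" where
  "gdist n T a b = (LEAST k. (a, b) \<in> adj n T ^^ k)"

definition pointed_trees :: "nat \<Rightarrow> cgraph set" where
  "pointed_trees n = {T. subgraph n T \<and> connected_graph n T \<and> infinite (verts T) \<and>
                         \<one>\<^bsub>free_group n\<^esub> \<in> verts T}"

text \<open>
  An isometry between subgraphs preserving oriented labelled edges is determined by its effect on
  vertices: a distance-preserving bijection of the vertex sets which maps the edge labelled \<open>h\<close>
  from \<open>a\<close> to \<open>b\<close> to the edge labelled \<open>h\<close> from \<open>f a\<close> to \<open>f b\<close>, and likewise for its inverse.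
\<close>

definition labelled_edge :: "nat \<Rightarrow> cgraph \<Rightarrow> word \<Rightarrow> word \<Rightarrow> word \<Rightarrow> bool" where
  "labelled_edge n T a h b \<longleftrightarrow> (a, h) \<in> edges T \<and> b = a \<otimes>\<^bsub>free_group n\<^esub> h"

definition pointed_iso :: "nat \<Rightarrow> cgraph \<times> word \<Rightarrow> cgraph \<times> word \<Rightarrow> bool" where
  "pointed_iso n = (\<lambda>(T, g) (T', g').
     \<exists>f. bij_betw f (verts T) (verts T') \<and> f g = g' \<and>
       (\<forall>a\<in>verts T. \<forall>b\<in>verts T. gdist n T' (f a) (f b) = gdist n T a b) \<and>
       (\<forall>a\<in>verts T. \<forall>b\<in>verts T. \<forall>h\<in>free_gens n.
          labelled_edge n T' (f a) h (f b) \<longleftrightarrow> labelled_edge n T a h b))"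

definition tree_ball :: "nat \<Rightarrow> cgraph \<Rightarrow> nat \<Rightarrow> cgraph" where
  "tree_ball n T r =
     (let B = {v \<in> verts T. gdist n T \<one>\<^bsub>free_group n\<^esub> v \<le> r}
      in \<lparr>verts = B, edges = {(g, h) \<in> edges T. g \<in> B \<and> g \<otimes>\<^bsub>free_group n\<^esub> h \<in> B}\<rparr>)"

definition agree_radius :: "nat \<Rightarrow> cgraph \<Rightarrow> cgraph \<Rightarrow> nat" where
  "agree_radius n T T' =
     (GREATEST r. pointed_iso n (tree_ball n T r, \<one>\<^bsub>free_group n\<^esub>)
                                (tree_ball n T' r, \<one>\<^bsub>free_group n\<^esub>))"

definition tree_dist :: "nat \<Rightarrow> cgraph \<Rightarrow> cgraph \<Rightarrow> real" where
  "tree_dist n T T' = (if T = T' then 0 else exp (- real (agree_radius n T T')))"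

definition tree_topology :: "nat \<Rightarrow> cgraph topology" where
  "tree_topology n = Metric_space.mtopology (pointed_trees n) (tree_dist n)"


section \<open>Pseudogroups\<close>

text \<open>A local homeomorphism is represented by its graph.\<close>

definition local_homeo :: "'a topology \<Rightarrow> 'a rel \<Rightarrow> bool" where
  "local_homeo X R \<longleftrightarrow> openin X (Domain R) \<and> openin X (Range R) \<and>
     (\<exists>f. R = {(x, f x) | x. x \<in> Domain R} \<and>
          homeomorphic_map (subtopology X (Domain R)) (subtopology X (Range R)) f)"

definition pseudogroup :: "'a topology \<Rightarrow> 'a rel set \<Rightarrow> bool" where
  "pseudogroup X P \<longleftrightarrow>
     (\<forall>R\<in>P. local_homeo X R) \<and>
     Id_on (topspace X) \<in> P \<and>
     (\<forall>R\<in>P. R\<inverse> \<in> P) \<and>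
     (\<forall>R\<in>P. \<forall>Q\<in>P. R O Q \<in> P) \<and>
     (\<forall>R\<in>P. \<forall>W. openin X W \<longrightarrow> {(x, y) \<in> R. x \<in> W} \<in> P) \<and>
     (\<forall>\<Q>\<subseteq>P. local_homeo X (\<Union>\<Q>) \<longrightarrow> \<Union>\<Q> \<in> P)"

definition generated_pseudogroup :: "'a topology \<Rightarrow> 'a rel set \<Rightarrow> 'a rel set" where
  "generated_pseudogroup X \<G> = \<Inter>{P. pseudogroup X P \<and> \<G> \<subseteq> P}"

definition restrict_pseudogroup :: "'a rel set \<Rightarrow> 'a set \<Rightarrow> 'a rel set" where
  "restrict_pseudogroup P Y = {R \<in> P. Domain R \<subseteq> Y \<and> Range R \<subseteq> Y}"

definition push_pseudogroup :: "('a \<Rightarrow> 'b) \<Rightarrow> 'a rel set \<Rightarrow> 'b rel set" where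
  "push_pseudogroup t P = (\<lambda>R. map_prod t t ` R) ` P"

definition tree_shift :: "nat \<Rightarrow> cgraph \<Rightarrow> word \<Rightarrow> cgraph" where
  "tree_shift n T g =
     (THE T'. T' \<in> pointed_trees n \<and> pointed_iso n (T, g) (T', \<one>\<^bsub>free_group n\<^esub>))"

definition tree_gamma :: "nat \<Rightarrow> word \<Rightarrow> cgraph rel" where
  "tree_gamma n g = {(T, tree_shift n T g) | T. T \<in> pointed_trees n \<and> g \<in> verts T}"

definition tree_pseudogroup :: "nat \<Rightarrow> cgraph rel set" where
  "tree_pseudogroup n = generated_pseudogroup (tree_topology n) (tree_gamma n ` free_gens n)"


section \<open>Differentiability classes\<close>

primrec Ck_open :: "nat \<Rightarrow> 'a::real_normed_vector set \<Rightarrow> ('a \<Rightarrow> 'b::real_normed_vector) \<Rightarrow> bool" where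
  "Ck_open 0 S f \<longleftrightarrow> continuous_on S f"
| "Ck_open (Suc k) S f \<longleftrightarrow>
     (\<exists>f'. (\<forall>x\<in>S. (f has_derivative f' x) (at x)) \<and> (\<forall>v. Ck_open k S (\<lambda>x. f' x v)))"

text \<open>
  The map \<open>f\<close> is of class \<open>C\<^sup>r\<close> on an arbitrary set \<open>S\<close> if near each point of \<open>S\<close> it agrees on \<open>S\<close>
  with a map of class \<open>C\<^sup>k\<close> on an open set, for each finite \<open>k \<le> r\<close>. Below, \<open>S\<close> is open in the
  whole space or in a linear subspace or a translate of one, where this is the usual notion.
\<close>

definition Cr_on :: "enat \<Rightarrow> 'a::real_normed_vector set \<Rightarrow> ('a \<Rightarrow> 'b::real_normed_vector) \<Rightarrow> bool" where
  "Cr_on r S f \<longleftrightarrow> (\<forall>k. enat k \<le> r \<longrightarrow>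
     (\<forall>x\<in>S. \<exists>W F. open W \<and> x \<in> W \<and> Ck_open k W F \<and> (\<forall>y\<in>S \<inter> W. F y = f y)))"

text \<open>
  Maps \<open>f (u, y)\<close> that are \<open>C\<^sup>k\<close> in \<open>u\<close>, with all derivatives in \<open>u\<close> continuous in \<open>(u, y)\<close>.
\<close>

primrec leafwise_Ck ::
  "nat \<Rightarrow> ('a::real_normed_vector \<times> 'y::topological_space) set \<Rightarrow>
   ('a \<times> 'y \<Rightarrow> 'b::real_normed_vector) \<Rightarrow> bool" where
  "leafwise_Ck 0 S f \<longleftrightarrow> continuous_on S f"
| "leafwise_Ck (Suc k) S f \<longleftrightarrow> continuous_on S f \<and>
     (\<exists>f'. (\<forall>(u, y)\<in>S. ((\<lambda>u'. f (u', y)) has_derivative f' (u, y)) (at u)) \<and>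
           (\<forall>v. leafwise_Ck k S (\<lambda>z. f' z v)))"


section \<open>Foliated charts, leaves and holonomy\<close>

text \<open>
  A foliated chart with domain \<open>cdom\<close> consists of a leaf coordinate \<open>lc\<close> and a transverse
  coordinate \<open>tc\<close>; its plaques are the sets of points of \<open>cdom\<close> with the same transverse coordinate.
  The definitions in this section are shared by laminations (whose transversals are Cantor sets)
  and foliations of manifolds.
\<close>

record ('x, 'a, 'y) fchart =
  cdom :: "'x set"
  lc :: "'x \<Rightarrow> 'a"
  tc :: "'x \<Rightarrow> 'y"

definition fmap :: "('x, 'a, 'y) fchart \<Rightarrow> 'x \<Rightarrow> 'a \<times> 'y" where
  "fmap c x = (lc c x, tc c x)"

definition coherent :: "('x::topological_space, 'a, 'y) fchart set \<Rightarrow> bool" where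
  "coherent A \<longleftrightarrow> (\<forall>c\<in>A. \<forall>c'\<in>A. \<forall>x\<in>cdom c \<inter> cdom c'.
     \<exists>W h. open W \<and> x \<in> W \<and> W \<subseteq> cdom c \<inter> cdom c' \<and> (\<forall>w\<in>W. tc c' w = h (tc c w)))"

definition same_plaque :: "('x, 'a, 'y) fchart set \<Rightarrow> 'x rel" where
  "same_plaque A = {(x, y). \<exists>c\<in>A. x \<in> cdom c \<and> y \<in> cdom c \<and> tc c x = tc c y}"

definition leaf :: "('x, 'a, 'y) fchart set \<Rightarrow> 'x \<Rightarrow> 'x set" where
  "leaf A x = {y. (x, y) \<in> (same_plaque A)\<^sup>*}"

text \<open>
  An atlas of the leaf \<open>L\<close>, with its leaf topology, by charts with values in the model space \<open>P'\<close>
  which are \<open>C\<^sup>r\<close>-compatible with the leaf coordinates of \<open>A\<close>; these take values in the model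
  space \<open>P\<close>. Both \<open>P\<close> and \<open>P'\<close> are linear subspaces.
\<close>

definition leaf_atlas ::
  "enat \<Rightarrow> 'a::real_normed_vector set \<Rightarrow> 'b::real_normed_vector set \<Rightarrow> ('x, 'a, 'y) fchart set \<Rightarrow>
   'x set \<Rightarrow> ('x set \<times> ('x \<Rightarrow> 'b)) set \<Rightarrow> bool" where
  "leaf_atlas r P P' A L C \<longleftrightarrow> (\<Union>(W, \<zeta>)\<in>C. W) = L \<and>
     (\<forall>(W, \<zeta>)\<in>C. inj_on \<zeta> W \<and>
       (\<forall>c\<in>A. \<forall>\<eta>. let S = {x \<in> W \<inter> cdom c. tc c x = \<eta>} in
          openin (top_of_set P) (lc c ` S) \<and> openin (top_of_set P') (\<zeta> ` S) \<and>
          Cr_on r (lc c ` S) (\<zeta> \<circ> inv_into S (lc c)) \<and>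
          Cr_on r (\<zeta> ` S) (lc c \<circ> inv_into S \<zeta>)))"

definition smooth_leaf ::
  "enat \<Rightarrow> 'a::real_normed_vector set \<Rightarrow> ('x, 'a, 'y) fchart set \<Rightarrow> 'x set \<Rightarrow> bool" where
  "smooth_leaf r P A L \<longleftrightarrow> (\<exists>C :: ('x set \<times> ('x \<Rightarrow> 'a)) set. leaf_atlas r P P A L C \<and>
     (\<forall>(W, \<zeta>)\<in>C. \<forall>(W', \<zeta>')\<in>C. Cr_on \<infinity> (\<zeta> ` (W \<inter> W')) (\<zeta>' \<circ> inv_into (W \<inter> W') \<zeta>)))"

definition riemann_surface_leaf ::
  "('x, 'a::real_normed_vector, 'y) fchart set \<Rightarrow> 'x set \<Rightarrow> bool" where
  "riemann_surface_leaf A L \<longleftrightarrow> (\<exists>C :: ('x set \<times> ('x \<Rightarrow> complex)) set.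
     leaf_atlas \<infinity> UNIV UNIV A L C \<and>
     (\<forall>(W, \<zeta>)\<in>C. \<forall>(W', \<zeta>')\<in>C.
        (\<zeta>' \<circ> inv_into (W \<inter> W') \<zeta>) holomorphic_on (\<zeta> ` (W \<inter> W'))))"

definition transversal :: "('x, 'a, 'y) fchart set \<Rightarrow> 'y set" where
  "transversal A = (\<Union>c\<in>A. tc c ` cdom c)"

text \<open>
  The holonomy pseudogroup is generated by the changes of transverse coordinate
  \<open>tc c w \<mapsto> tc c' w\<close>, for \<open>w\<close> in open subsets of \<open>cdom c \<inter> cdom c'\<close> on which this is a local
  homeomorphism of the transversal.
\<close>

definition holonomy_pseudogroup ::
  "('x::topological_space, 'a, 'y::topological_space) fchart set \<Rightarrow> 'y rel set" where
  "holonomy_pseudogroup A = generated_pseudogroup (top_of_set (transversal A))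
     {R. local_homeo (top_of_set (transversal A)) R \<and>
         (\<exists>c\<in>A. \<exists>c'\<in>A. \<exists>W. open W \<and> W \<subseteq> cdom c \<inter> cdom c' \<and>
            R = (\<lambda>w. (tc c w, tc c' w)) ` W)}"


section \<open>The suspension\<close>

definition cantor_set :: "'a::topological_space set \<Rightarrow> bool" where
  "cantor_set Y \<longleftrightarrow>
     top_of_set Y homeomorphic_space product_topology (\<lambda>_::nat. discrete_topology (UNIV::bool set)) UNIV"

text \<open>
  A compact metric space, the type \<open>'m\<close>, with a finite smooth foliated atlas \<open>A\<close> modelled on
  \<open>U\<^sub>c \<times> \<XX>\<^sub>c\<close>, where \<open>U\<^sub>c = lc c ` cdom c\<close> is open in the plane and \<open>\<XX>\<^sub>c = tc c ` cdom c\<close> is a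
  Cantor set. The \<open>\<XX>\<^sub>c\<close> are identified with disjoint local transversals, so they are subsets
  of \<open>'m\<close>, and \<open>tc c\<close> is the projection onto \<open>\<XX>\<^sub>c\<close> along the plaques of \<open>c\<close>.
  The sets \<open>U\<^sub>c\<close> are connected since plaques are.
\<close>

definition smooth_lamination_atlas :: "('m::metric_space, real^2, 'm) fchart set \<Rightarrow> bool" where
  "smooth_lamination_atlas A \<longleftrightarrow> finite A \<and> (\<Union>c\<in>A. cdom c) = UNIV \<and>
     (\<forall>c\<in>A. open (cdom c) \<and> open (lc c ` cdom c) \<and> connected (lc c ` cdom c) \<and>
        cantor_set (tc c ` cdom c) \<and>
        (\<exists>\<psi>. homeomorphism (cdom c) ((lc c ` cdom c) \<times> (tc c ` cdom c)) (fmap c) \<psi>) \<and>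
        tc c ` cdom c \<subseteq> cdom c \<and> (\<forall>x\<in>tc c ` cdom c. tc c x = x)) \<and>
     (\<forall>c\<in>A. \<forall>c'\<in>A. c \<noteq> c' \<longrightarrow> tc c ` cdom c \<inter> tc c' ` cdom c' = {}) \<and>
     coherent A \<and>
     (\<forall>c\<in>A. \<forall>c'\<in>A. \<forall>k. leafwise_Ck k (fmap c ` (cdom c \<inter> cdom c'))
        (lc c' \<circ> inv_into (cdom c \<inter> cdom c') (fmap c)))"

definition is_suspension ::
  "nat \<Rightarrow> ('m::metric_space, real^2, 'm) fchart set \<Rightarrow> (cgraph \<Rightarrow> 'm) \<Rightarrow> bool" where
  "is_suspension n A t \<longleftrightarrow>
     compact (UNIV :: 'm set) \<and>
     smooth_lamination_atlas A \<and>
     (\<forall>x. riemann_surface_leaf A (leaf A x)) \<and>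
     t ` pointed_trees n \<subseteq> transversal A \<and>
     homeomorphic_map (tree_topology n) (top_of_set (t ` pointed_trees n)) t \<and>
     openin (top_of_set (transversal A)) (t ` pointed_trees n) \<and>
     closedin (top_of_set (transversal A)) (t ` pointed_trees n) \<and>
     (\<forall>x. leaf A x \<inter> t ` pointed_trees n \<noteq> {}) \<and>
     restrict_pseudogroup (holonomy_pseudogroup A) (t ` pointed_trees n)
       = push_pseudogroup t (tree_pseudogroup n) \<and>
     (\<exists>K>0. \<forall>T\<in>pointed_trees n. \<forall>T'\<in>pointed_trees n.
        1 / K * tree_dist n T T' \<le> dist (t T) (t T') \<and> dist (t T) (t T') \<le> K * tree_dist n T T')"


section \<open>Smooth manifolds and Riemannian distance\<close>

type_synonym ('x, 'e) mchart = "'x set \<times> ('x \<Rightarrow> 'e)"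

definition transition :: "('x, 'e) mchart \<Rightarrow> ('x, 'f) mchart \<Rightarrow> 'e \<Rightarrow> 'f" where
  "transition c c' = snd c' \<circ> inv_into (fst c \<inter> fst c') (snd c)"

definition Cr_compatible ::
  "enat \<Rightarrow> ('x, 'e::real_normed_vector) mchart \<Rightarrow> ('x, 'f::real_normed_vector) mchart \<Rightarrow> bool" where
  "Cr_compatible r c c' \<longleftrightarrow>
     Cr_on r (snd c ` (fst c \<inter> fst c')) (transition c c') \<and>
     Cr_on r (snd c' ` (fst c \<inter> fst c')) (transition c' c)"

definition topological_chart :: "('x::topological_space, 'e::euclidean_space) mchart \<Rightarrow> bool" where
  "topological_chart c \<longleftrightarrow> open (fst c) \<and> open (snd c ` fst c) \<and>
     (\<exists>\<psi>. homeomorphism (fst c) (snd c ` fst c) (snd c) \<psi>)"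

text \<open>The manifold is the type \<open>'x\<close>; it has dimension \<open>DIM('e)\<close> and need not be connected.\<close>

definition smooth_manifold ::
  "('x::{t2_space, second_countable_topology}, 'e::euclidean_space) mchart set \<Rightarrow> bool" where
  "smooth_manifold \<A> \<longleftrightarrow> (\<Union>c\<in>\<A>. fst c) = UNIV \<and> (\<forall>c\<in>\<A>. topological_chart c) \<and>
     (\<forall>c\<in>\<A>. \<forall>c'\<in>\<A>. Cr_compatible \<infinity> c c')"

text \<open>\<open>g c p\<close> is the metric tensor at \<open>p\<close> in the coordinates of the chart \<open>c\<close>.\<close>

definition riemannian_metric ::
  "('x, 'e::euclidean_space) mchart set \<Rightarrow>
   (('x, 'e) mchart \<Rightarrow> 'x \<Rightarrow> 'e \<Rightarrow> 'e \<Rightarrow> real) \<Rightarrow> bool" where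
  "riemannian_metric \<A> g \<longleftrightarrow>
     (\<forall>c\<in>\<A>. \<forall>p\<in>fst c. bilinear (g c p) \<and> (\<forall>v w. g c p v w = g c p w v) \<and>
        (\<forall>v. v \<noteq> 0 \<longrightarrow> g c p v v > 0)) \<and>
     (\<forall>c\<in>\<A>. \<forall>v w. Cr_on \<infinity> (snd c ` fst c) (\<lambda>z. g c (inv_into (fst c) (snd c) z) v w)) \<and>
     (\<forall>c\<in>\<A>. \<forall>c'\<in>\<A>. \<forall>p\<in>fst c \<inter> fst c'. \<forall>v w.
        (let D = frechet_derivative (transition c c') (at (snd c p))
         in g c p v w = g c' p (D v) (D w)))"

definition piecewise_C1_curve ::
  "('x::topological_space, 'e::euclidean_space) mchart set \<Rightarrow> (real \<Rightarrow> 'x) \<Rightarrow> bool" where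
  "piecewise_C1_curve \<A> \<gamma> \<longleftrightarrow> continuous_on {0..1} \<gamma> \<and>
     (\<forall>c\<in>\<A>. \<forall>a b. 0 \<le> a \<longrightarrow> b \<le> 1 \<longrightarrow> \<gamma> ` {a..b} \<subseteq> fst c \<longrightarrow>
        (snd c \<circ> \<gamma>) piecewise_C1_differentiable_on {a..b})"

text \<open>
  The speed does not depend on the chart around \<open>\<gamma> s\<close> used to compute it, except at the finitely
  many \<open>s\<close> where \<open>\<gamma>\<close> is not differentiable.
\<close>

definition speed ::
  "('x, 'e::euclidean_space) mchart set \<Rightarrow> (('x, 'e) mchart \<Rightarrow> 'x \<Rightarrow> 'e \<Rightarrow> 'e \<Rightarrow> real) \<Rightarrow>
   (real \<Rightarrow> 'x) \<Rightarrow> real \<Rightarrow> real" where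
  "speed \<A> g \<gamma> s =
     (let c = (SOME c. c \<in> \<A> \<and> \<gamma> s \<in> fst c); v = vector_derivative (snd c \<circ> \<gamma>) (at s)
      in sqrt (g c (\<gamma> s) v v))"

definition curve_length ::
  "('x, 'e::euclidean_space) mchart set \<Rightarrow> (('x, 'e) mchart \<Rightarrow> 'x \<Rightarrow> 'e \<Rightarrow> 'e \<Rightarrow> real) \<Rightarrow>
   (real \<Rightarrow> 'x) \<Rightarrow> ennreal" where
  "curve_length \<A> g \<gamma> = (\<integral>\<^sup>+ s \<in> {0..1}. ennreal (speed \<A> g \<gamma> s) \<partial>lborel)"

text \<open>The distance is \<open>\<infinity>\<close> between points in different connected components.\<close>

definition riemannian_dist ::
  "('x::topological_space, 'e::euclidean_space) mchart set \<Rightarrow>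
   (('x, 'e) mchart \<Rightarrow> 'x \<Rightarrow> 'e \<Rightarrow> 'e \<Rightarrow> real) \<Rightarrow> 'x \<Rightarrow> 'x \<Rightarrow> ennreal" where
  "riemannian_dist \<A> g x y =
     Inf (curve_length \<A> g ` {\<gamma>. piecewise_C1_curve \<A> \<gamma> \<and> \<gamma> 0 = x \<and> \<gamma> 1 = y})"


section \<open>Foliations of manifolds\<close>

text \<open>
  The transverse coordinates of a foliated chart of a manifold are the coordinates with respect to
  a subset \<open>B\<close> of the standard basis, so the codimension is \<open>card B\<close>. The range of a foliated chart
  is a (possibly unbounded) open rectangle, so that plaques are connected.
\<close>

definition coord_proj :: "'e::euclidean_space set \<Rightarrow> 'e \<Rightarrow> 'e" where
  "coord_proj B z = (\<Sum>b\<in>B. (z \<bullet> b) *\<^sub>R b)"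

definition foliated_chart_of ::
  "'e::euclidean_space set \<Rightarrow> ('x, 'e) mchart \<Rightarrow> ('x, 'e, 'e) fchart" where
  "foliated_chart_of B c =
     \<lparr>cdom = fst c, lc = coord_proj (Basis - B) \<circ> snd c, tc = coord_proj B \<circ> snd c\<rparr>"

abbreviation foliated_charts ::
  "'e::euclidean_space set \<Rightarrow> ('x, 'e) mchart set \<Rightarrow> ('x, 'e, 'e) fchart set" where
  "foliated_charts B \<F> \<equiv> foliated_chart_of B ` \<F>"

text \<open>
  Foliations of class \<open>C\<^sup>\<infinity>\<^sup>,\<^sup>r\<close>: there is a foliated atlas \<open>\<F>\<close> of class \<open>C\<^sup>r\<close>, and every leaf has a
  structure of a smooth manifold, compatible with the \<open>C\<^sup>r\<close> structure given by the plaques of \<open>\<F>\<close>.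
\<close>

definition Cinf_r_foliation ::
  "enat \<Rightarrow> ('x::topological_space, 'e::euclidean_space) mchart set \<Rightarrow> 'e set \<Rightarrow>
   ('x, 'e) mchart set \<Rightarrow> bool" where
  "Cinf_r_foliation r \<A> B \<F> \<longleftrightarrow> B \<subseteq> Basis \<and>
     (\<Union>c\<in>\<F>. fst c) = UNIV \<and>
     (\<forall>c\<in>\<F>. topological_chart c \<and> is_interval (snd c ` fst c)) \<and>
     (\<forall>c\<in>\<F>. \<forall>c'\<in>\<A>. Cr_compatible r c c') \<and>
     (\<forall>c\<in>\<F>. \<forall>c'\<in>\<F>. Cr_compatible r c c') \<and>
     coherent (foliated_charts B \<F>) \<and>
     (\<forall>x. smooth_leaf r (span (Basis - B)) (foliated_charts B \<F>) (leaf (foliated_charts B \<F>) x))"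

definition saturated :: "('x, 'a, 'y) fchart set \<Rightarrow> 'x set \<Rightarrow> bool" where
  "saturated A Z \<longleftrightarrow> (\<forall>z\<in>Z. leaf A z \<subseteq> Z)"

definition foliated_embedding ::
  "('m::topological_space, 'a, 'y) fchart set \<Rightarrow> ('x::topological_space, 'b, 'z) fchart set \<Rightarrow>
   ('m \<Rightarrow> 'x) \<Rightarrow> bool" where
  "foliated_embedding A A' \<phi> \<longleftrightarrow>
     (\<exists>\<psi>. homeomorphism UNIV (range \<phi>) \<phi> \<psi>) \<and> closed (range \<phi>) \<and> saturated A' (range \<phi>) \<and>
     (\<forall>x. \<phi> ` leaf A x = leaf A' (\<phi> x))"

definition bi_lipschitz :: "('x \<Rightarrow> 'x \<Rightarrow> ennreal) \<Rightarrow> ('m::metric_space \<Rightarrow> 'x) \<Rightarrow> bool" where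
  "bi_lipschitz d \<phi> \<longleftrightarrow> (\<exists>K>0. \<forall>x y.
     ennreal (1 / K * dist x y) \<le> d (\<phi> x) (\<phi> y) \<and> d (\<phi> x) (\<phi> y) \<le> ennreal (K * dist x y))"

end

theory Submission
  imports Defs "HOL-Real_Asymp.Real_Asymp"
begin

text \<open>
  The obstruction is metric: with the ball metric, the space of pointed trees has infinite box
  dimension, whereas a compact subset of a manifold of dimension \<open>d\<close> has box dimension at most \<open>d\<close>
  for the distance of a Riemannian metric, and bi-Lipschitz maps preserve box dimension.

  For the first half (\<open>separated_trees\<close>), let a tree branch in all positive words on two generators
  up to length \<open>m\<close> and continue only above a chosen nonempty set of words of length \<open>m\<close>. The choices
  give \<open>2 ^ 2 ^ m - 1\<close> trees, any two of which already differ in their balls of radius \<open>m + 1\<close>, hence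
  lie at distance at least \<open>exp (- m)\<close>. For the second half (\<open>packing_bound_compact\<close> and
  \<open>riemannian_packing_bound_local\<close>), near each point the Riemannian distance is at most a constant
  times the Euclidean distance in a chart, as one sees by measuring straight segments. So points which
  are \<open>\<epsilon>\<close>-separated in the manifold have coordinates separated by a multiple of \<open>\<epsilon>\<close>, and only
  \<open>O(\<epsilon> ^ - d)\<close> of them fit into a compact set.

  An embedding as in the theorem would send the \<open>2 ^ 2 ^ m - 1\<close> trees to points of a fixed compact
  set, separated by a constant times \<open>exp (- m)\<close>. There is room for only \<open>O(exp (d * m))\<close> such points,
  which is impossible for large \<open>m\<close>.
\<close>

section \<open>Doubly exponentially many separated trees\<close>

text \<open>
  Positive words never cancel against each other, so that the product of the free group is
  concatenation on them and trees spanned by positive words are prefix-closed sets of lists.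
\<close>

definition positive_words :: "word set" where
  "positive_words = {w. set w \<subseteq> {(0, True), (1, True)}}"

text \<open>
  All positive words up to length \<open>m\<close>, and full binary trees above those words of length \<open>m\<close> that
  belong to \<open>S\<close>. Continuing for ever above \<open>S\<close> makes the graph infinite as soon as \<open>S\<close> is nonempty.
\<close>

definition branching_tree :: "nat \<Rightarrow> word set \<Rightarrow> cgraph" where
  "branching_tree m S =
     (let V = {w \<in> positive_words. m < length w \<longrightarrow> take m w \<in> S}
      in \<lparr>verts = V, edges = {(w, [x]) | w x. w @ [x] \<in> V}\<rparr>)"

lemma verts_branching_tree:
  "verts (branching_tree m S) = {w \<in> positive_words. m < length w \<longrightarrow> take m w \<in> S}"
  by (simp add: branching_tree_def Let_def)

lemma edges_branching_tree:
  "edges (branching_tree m S) = {(w, [x]) | w x. w @ [x] \<in> verts (branching_tree m S)}"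
  by (simp add: branching_tree_def Let_def)

lemma mult_positive:
  assumes "u \<in> positive_words" "v \<in> positive_words"
  shows "u \<otimes>\<^bsub>free_group n\<^esub> v = u @ v"
proof -
  have "foldr red_cons u v = u @ v"
    using assms
  proof (induction u)
    case (Cons x u)
    have IH: "foldr red_cons u v = u @ v"
      using Cons by (simp add: positive_words_def)
    have "inv_letter x \<notin> set (u @ v)"
      using Cons.prems by (auto simp: positive_words_def inv_letter_def)
    then have "red_cons x (u @ v) = x # u @ v" by (cases "u @ v") auto
    with IH show ?case by simp
  qed simp
  then show ?thesis by (simp add: free_group_def)
qed

lemma positive_in_free_group:
  assumes "n \<ge> 2" "w \<in> positive_words"
  shows "w \<in> carrier (free_group n)"
proof -
  have "reduced_word w"
    using assms(2) 
    by (induction w rule: reduced_word.induct) (simp_all add: positive_words_def inv_letter_def, force)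
  moreover have "fst ` set w \<subseteq> {..<n}"
    using assms by (force simp: positive_words_def)
  ultimately show ?thesis by (simp add: free_group_def)
qed

lemma positive_letter_in_free_gens:
  "n \<ge> 2 \<Longrightarrow> [x] \<in> positive_words \<Longrightarrow> [x] \<in> free_gens n"
  by (auto simp: positive_words_def free_gens_def)

lemma branching_tree_prefix:
  assumes "w @ u \<in> verts (branching_tree m S)"
  shows "w \<in> verts (branching_tree m S)"
  using assms by (auto simp: verts_branching_tree positive_words_def)

lemma branching_tree_last_letter:
  "w @ [x] \<in> verts (branching_tree m S) \<Longrightarrow> w \<in> positive_words \<and> [x] \<in> positive_words"
  by (auto simp: verts_branching_tree positive_words_def)

lemma branching_tree_step:
  assumes "w @ [x] \<in> verts (branching_tree m S)"
  shows "(w, [x]) \<in> edges (branching_tree m S)" "w \<otimes>\<^bsub>free_group n\<^esub> [x] = w @ [x]"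
  using assms branching_tree_last_letter[OF assms]
  by (cases x; auto simp: edges_branching_tree mult_positive)+

lemma branching_tree_relpow:
  assumes "w \<in> verts (branching_tree m S)"
  shows "([], w) \<in> adj n (branching_tree m S) ^^ length w"
  using assms
proof (induction w rule: rev_induct)
  case (snoc x w)
  have "(w, w @ [x]) \<in> adj n (branching_tree m S)"
    unfolding adj_def using branching_tree_step(1)[OF snoc.prems]
      branching_tree_step(2)[OF snoc.prems, of n] by force
  with snoc.IH branching_tree_prefix[OF snoc.prems] show ?case by auto
qed simp

lemma gdist_branching_tree_le:
  assumes "w \<in> verts (branching_tree m S)"
  shows "gdist n (branching_tree m S) [] w \<le> length w"
  unfolding gdist_def by (rule Least_le) (rule branching_tree_relpow[OF assms])

lemma branching_tree_in_pointed_trees: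
  assumes n: "n \<ge> 2" and w: "w \<in> S" "w \<in> positive_words" "length w = m"
  shows "branching_tree m S \<in> pointed_trees n"
proof -
  let ?T = "branching_tree m S"
  have "subgraph n ?T"
  proof -
    have "h \<in> free_gens n \<and> g \<in> carrier (free_group n) \<and> g \<in> verts ?T \<and>
        g \<otimes>\<^bsub>free_group n\<^esub> h \<in> verts ?T" if gh: "(g, h) \<in> edges ?T" for g h
    proof -
      obtain x where x: "h = [x]" "g @ [x] \<in> verts ?T"
        using gh unfolding edges_branching_tree mem_Collect_eq prod.inject by blast
      from branching_tree_last_letter[OF x(2)] branching_tree_prefix[OF x(2)]
        branching_tree_step(2)[OF x(2), of n] x
      show ?thesis
        using positive_in_free_group[OF n] positive_letter_in_free_gens[OF n] by auto
    qed
    moreover have "verts ?T \<subseteq> carrier (free_group n)"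
      using positive_in_free_group[OF n] by (auto simp: verts_branching_tree)
    ultimately show ?thesis
      unfolding subgraph_def cayley_def by auto
  qed
  moreover have "connected_graph n ?T"
  proof -
    have root: "([], a) \<in> (adj n ?T)\<^sup>*" if "a \<in> verts ?T" for a
      using branching_tree_relpow[OF that] by (rule relpow_imp_rtrancl)
    have "sym (adj n ?T)" by (force simp: adj_def sym_def)
    then have "sym ((adj n ?T)\<^sup>*)" by (rule sym_rtrancl)
    with root show ?thesis
      unfolding connected_graph_def by (meson rtrancl_trans symD)
  qed
  moreover have "infinite (verts ?T)"
  proof -
    have "(\<lambda>k. w @ replicate k (0, True)) ` UNIV \<subseteq> verts ?T"
      using w by (auto simp: verts_branching_tree positive_words_def)
    moreover have "inj (\<lambda>k::nat. w @ replicate k (0::nat, True))"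
      by (rule injI) (metis length_replicate same_append_eq)
    ultimately show ?thesis
      by (meson finite_imageD finite_subset infinite_UNIV_nat)
  qed
  moreover have "\<one>\<^bsub>free_group n\<^esub> \<in> verts ?T"
    by (simp add: free_group_def verts_branching_tree positive_words_def)
  ultimately show ?thesis by (simp add: pointed_trees_def)
qed

text \<open>
  Balls of radius \<open>0\<close> are all equal. This makes the agreement radius meaningful: \<open>GREATEST\<close> has the
  expected value only if some radius of agreement exists and these radii are bounded.
\<close>

lemma tree_ball_0:
  assumes "T \<in> pointed_trees n"
  shows "tree_ball n T 0 = \<lparr>verts = {\<one>\<^bsub>free_group n\<^esub>}, edges = {}\<rparr>"
proof -
  interpret group "free_group n" by (rule group_free_group)
  let ?e = "\<one>\<^bsub>free_group n\<^esub>"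
  have T: "?e \<in> verts T" "subgraph n T" "connected_graph n T"
    using assms by (auto simp: pointed_trees_def)
  have zero: "gdist n T ?e v = 0 \<longleftrightarrow> v = ?e" if v: "v \<in> verts T" for v
  proof
    obtain k where "(?e, v) \<in> adj n T ^^ k"
      using T v unfolding connected_graph_def by (meson rtrancl_imp_relpow)
    then have "(?e, v) \<in> adj n T ^^ gdist n T ?e v"
      unfolding gdist_def by (rule LeastI)
    then show "v = ?e" if "gdist n T ?e v = 0" using that by simp
    show "gdist n T ?e v = 0" if "v = ?e"
      unfolding gdist_def using that by (intro Least_eq_0) simp
  qed
  have "(?e, h) \<notin> edges T" if "?e \<otimes>\<^bsub>free_group n\<^esub> h = ?e" for h
  proof
    assume "(?e, h) \<in> edges T"
    then have "h \<in> free_gens n" using T(2) by (auto simp: subgraph_def cayley_def)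
    then have "foldr red_cons [] h \<noteq> []" by (auto simp: free_gens_def)
    with that show False by (simp add: free_group_def)
  qed
  then show ?thesis
    using zero T(1) by (auto simp: tree_ball_def Let_def)
qed

lemma pointed_iso_refl: "pointed_iso n (T, g) (T, g)"
  unfolding pointed_iso_def by (auto intro!: exI[of _ id])

text \<open>
  An isomorphism preserving the root and the labels is forced to fix every vertex, because a vertex
  is determined by the labels along the path from the root. So a ball of radius \<open>m + 1\<close> remembers
  above which words of length \<open>m\<close> the tree continues.
\<close>

lemma pointed_iso_branching_tree_subset:
  assumes n: "n \<ge> 2" and k: "m < k" and S: "S \<subseteq> {w \<in> positive_words. length w = m}"
    and iso: "pointed_iso n (tree_ball n (branching_tree m S) k, \<one>\<^bsub>free_group n\<^esub>)
                            (tree_ball n (branching_tree m S') k, \<one>\<^bsub>free_group n\<^esub>)"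
  shows "S \<subseteq> S'"
proof
  fix w
  assume w: "w \<in> S"
  let ?T = "branching_tree m S" and ?T' = "branching_tree m S'"
  let ?B = "tree_ball n ?T k" and ?B' = "tree_ball n ?T' k"
  have one: "\<one>\<^bsub>free_group n\<^esub> = []" by (simp add: free_group_def)
  obtain f where f: "bij_betw f (verts ?B) (verts ?B')" "f [] = []"
    and lab: "\<And>a b h. a \<in> verts ?B \<Longrightarrow> b \<in> verts ?B \<Longrightarrow> h \<in> free_gens n \<Longrightarrow>
      labelled_edge n ?B' (f a) h (f b) \<longleftrightarrow> labelled_edge n ?B a h b"
    using iso unfolding pointed_iso_def one by auto
  have ball: "v \<in> verts ?B" if "v \<in> verts ?T" "length v \<le> k" for v
    using that gdist_branching_tree_le[OF that(1), of n] by (simp add: tree_ball_def one Let_def)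
  \<comment> \<open>Follow the labelled edges along the word, one letter at a time.\<close>
  have fix_word: "f v = v" if "v \<in> verts ?T" "length v \<le> k" for v
    using that
  proof (induction v rule: rev_induct)
    case (snoc x v)
    have v: "v \<in> verts ?T" using branching_tree_prefix[OF snoc.prems(1)] .
    have step: "(v, [x]) \<in> edges ?T" "v \<otimes>\<^bsub>free_group n\<^esub> [x] = v @ [x]"
      using branching_tree_step[OF snoc.prems(1)] by auto
    have B: "v \<in> verts ?B" "v @ [x] \<in> verts ?B"
      using ball[OF v] ball[OF snoc.prems] snoc.prems(2) by auto
    then have "labelled_edge n ?B v [x] (v @ [x])"
      using step by (auto simp: labelled_edge_def tree_ball_def Let_def)
    then have "labelled_edge n ?B' (f v) [x] (f (v @ [x]))"
      using lab[OF B] positive_letter_in_free_gens[OF n] branching_tree_last_letter[OF snoc.prems(1)]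
      by blast
    then show ?case
      using snoc.IH[OF v] snoc.prems(2) step(2) by (simp add: labelled_edge_def)
  qed (simp add: f)
  \<comment> \<open>A vertex one step above w witnesses that the tree continues there.\<close>
  let ?v = "w @ [(0, True)]"
  have v: "?v \<in> verts ?T" "length ?v \<le> k"
    using w S k by (auto simp: verts_branching_tree positive_words_def)
  then have "?v \<in> verts ?B'"
    using fix_word[OF v] ball[OF v] f(1) by (metis bij_betw_apply)
  then have "?v \<in> verts ?T'" by (simp add: tree_ball_def Let_def)
  then show "w \<in> S'" using w S by (auto simp: verts_branching_tree)
qed

lemma tree_dist_branching_tree_ge:
  assumes n: "n \<ge> 2" and S: "S \<subseteq> {w \<in> positive_words. length w = m}"
    and S': "S' \<subseteq> {w \<in> positive_words. length w = m}" "S' \<noteq> {}" and "\<not> S \<subseteq> S'"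
  shows "tree_dist n (branching_tree m S) (branching_tree m S') \<ge> exp (- real m)"
proof -
  let ?T = "branching_tree m S" and ?T' = "branching_tree m S'"
  let ?P = "\<lambda>k. pointed_iso n (tree_ball n ?T k, \<one>\<^bsub>free_group n\<^esub>)
                             (tree_ball n ?T' k, \<one>\<^bsub>free_group n\<^esub>)"
  have trees: "?T \<in> pointed_trees n" "?T' \<in> pointed_trees n"
    using assms branching_tree_in_pointed_trees[OF n] by blast+
  have bound: "k \<le> m" if "?P k" for k
    using pointed_iso_branching_tree_subset[OF n _ S that] assms(5) by force
  have "?P 0"
    by (simp add: tree_ball_0[OF trees(1)] tree_ball_0[OF trees(2)] pointed_iso_refl)
  then have "?P (agree_radius n ?T ?T')"
    unfolding agree_radius_def using bound by (rule GreatestI_nat[where P = ?P])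
  then have "agree_radius n ?T ?T' \<le> m" by (rule bound)
  moreover have "?T \<noteq> ?T'"
  proof
    assume "?T = ?T'"
    then have "?P (Suc m)" by (simp add: pointed_iso_refl)
    then show False using bound by fastforce
  qed
  ultimately show ?thesis by (simp add: tree_dist_def)
qed

lemma card_positive_words: "card {w \<in> positive_words. length w = m} = 2 ^ m"
  and finite_positive_words: "finite {w \<in> positive_words. length w = m}"
proof -
  have eq: "{w \<in> positive_words. length w = m} =
      {w. set w \<subseteq> {(0::nat, True), (1, True)} \<and> length w = m}"
    by (auto simp: positive_words_def)
  show "card {w \<in> positive_words. length w = m} = 2 ^ m"
    unfolding eq by (subst card_lists_length_eq) (auto simp flip: numeral_2_eq_2)
  show "finite {w \<in> positive_words. length w = m}"
    unfolding eq by (rule finite_lists_length_eq) auto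
qed

text \<open>
  The disjunction reflects the one-sided inclusion above: for \<open>S \<noteq> S'\<close> the bound holds in the order
  in which the inclusion fails.
\<close>

lemma separated_trees:
  assumes n: "n \<ge> 2"
  shows "\<exists>X \<subseteq> pointed_trees n. finite X \<and> card X = 2 ^ 2 ^ m - 1 \<and>
    (\<forall>T\<in>X. \<forall>T'\<in>X. T \<noteq> T' \<longrightarrow> tree_dist n T T' \<ge> exp (- real m) \<or> tree_dist n T' T \<ge> exp (- real m))"
proof (intro exI conjI)
  let ?L = "{w \<in> positive_words. length w = m}"
  let ?I = "Pow ?L - {{}}"
  let ?X = "branching_tree m ` ?I"
  have fin: "finite ?I" using finite_positive_words by simp
  have sep: "tree_dist n (branching_tree m S) (branching_tree m S') \<ge> exp (- real m) \<or>
      tree_dist n (branching_tree m S') (branching_tree m S) \<ge> exp (- real m)"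
    if "S \<in> ?I" "S' \<in> ?I" "S \<noteq> S'" for S S'
  proof (cases "S \<subseteq> S'")
    case True
    then have "\<not> S' \<subseteq> S" using that by blast
    then show ?thesis using tree_dist_branching_tree_ge[OF n, of S' m S] that by blast
  next
    case False
    then show ?thesis using tree_dist_branching_tree_ge[OF n, of S m S'] that by blast
  qed
  have "inj_on (branching_tree m) ?I"
  proof (rule inj_onI, rule ccontr)
    fix S S' assume *: "S \<in> ?I" "S' \<in> ?I" "branching_tree m S = branching_tree m S'" "S \<noteq> S'"
    show False using sep[OF *(1,2,4)] exp_gt_zero[of "- real m"] *(3) by (simp add: tree_dist_def)
  qed
  then have "card ?X = card ?I" by (rule card_image)
  also have "\<dots> = 2 ^ 2 ^ m - 1"
    using finite_positive_words card_positive_words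
    by (subst card_Diff_subset) (auto simp: card_Pow)
  finally show "card ?X = 2 ^ 2 ^ m - 1" .
  show "finite ?X" using fin by simp
  show "?X \<subseteq> pointed_trees n" using branching_tree_in_pointed_trees[OF n] by blast
  show "\<forall>T\<in>?X. \<forall>T'\<in>?X. T \<noteq> T' \<longrightarrow>
    tree_dist n T T' \<ge> exp (- real m) \<or> tree_dist n T' T \<ge> exp (- real m)"
    using sep by blast
qed

section \<open>Packing bounds\<close>

text \<open>
  Cut the space into half-open cubes of side \<open>\<delta> / d\<close>, where \<open>d\<close> is the dimension. Two points of one cube
  are closer than \<open>\<delta>\<close>, since the norm is at most the sum of the absolute coordinates, so each cube
  contains at most one point, and the ball of radius \<open>R\<close> meets only the stated number of cubes.
\<close>

lemma card_separated_le:
  fixes h :: "'b \<Rightarrow> 'e::euclidean_space"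
  assumes "finite P" "\<delta> > 0" and R: "\<And>x. x \<in> P \<Longrightarrow> norm (h x) \<le> R"
    and sep: "\<And>x y. x \<in> P \<Longrightarrow> y \<in> P \<Longrightarrow> x \<noteq> y \<Longrightarrow> norm (h x - h y) \<ge> \<delta>"
    and "R \<ge> 0"
  shows "real (card P) \<le> (2 * R * DIM('e) / \<delta> + 3) ^ DIM('e)"
proof -
  define s where "s = DIM('e) / \<delta>"
  have s: "s > 0" using assms by (simp add: s_def)
  define k where "k = (\<lambda>x. \<lambda>b\<in>Basis. \<lfloor>(h x \<bullet> b) * s\<rfloor>)"
  define L where "L = \<lceil>R * s\<rceil>"
  have L: "L \<ge> 0" using s assms(5) by (simp add: L_def) (smt (verit) mult_nonneg_nonneg)
  have "inj_on k P"
  proof (rule inj_onI, rule ccontr)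
    fix x y assume xy: "x \<in> P" "y \<in> P" "k x = k y" "x \<noteq> y"
    have "\<bar>(h x - h y) \<bullet> b\<bar> < 1 / s" if b: "b \<in> Basis" for b
    proof -
      have "\<lfloor>(h x \<bullet> b) * s\<rfloor> = \<lfloor>(h y \<bullet> b) * s\<rfloor>"
        using fun_cong[OF xy(3), of b] b by (simp add: k_def)
      then have "\<bar>(h x \<bullet> b) * s - (h y \<bullet> b) * s\<bar> < 1" by linarith
      also have "(h x \<bullet> b) * s - (h y \<bullet> b) * s = ((h x - h y) \<bullet> b) * s"
        by (simp add: algebra_simps inner_diff_left)
      finally show ?thesis using s by (simp add: abs_mult field_simps)
    qed
    then have "(\<Sum>b\<in>Basis. \<bar>(h x - h y) \<bullet> b\<bar>) < (\<Sum>b::'e\<in>Basis. 1 / s)"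
      by (intro sum_strict_mono) auto
    also have "\<dots> = \<delta>" using assms(2) by (simp add: s_def)
    finally have "norm (h x - h y) < \<delta>" using norm_le_l1[of "h x - h y"] by linarith
    then show False using sep[OF xy(1,2,4)] by simp
  qed
  moreover have "k ` P \<subseteq> Basis \<rightarrow>\<^sub>E {- L..L}"
  proof (rule image_subsetI)
    fix x assume x: "x \<in> P"
    have "\<lfloor>(h x \<bullet> b) * s\<rfloor> \<in> {- L..L}" if b: "b \<in> Basis" for b
    proof -
      have "\<bar>h x \<bullet> b\<bar> \<le> R" using Basis_le_norm[OF b] R[OF x] by (rule order_trans)
      then have "\<bar>(h x \<bullet> b) * s\<bar> \<le> R * s" using s by (simp add: abs_mult)
      then show ?thesis unfolding L_def by (simp add: floor_le_iff le_floor_iff) linarith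
    qed
    then show "k x \<in> Basis \<rightarrow>\<^sub>E {- L..L}" by (auto simp: k_def)
  qed
  ultimately have "card P \<le> card ((Basis :: 'e set) \<rightarrow>\<^sub>E {- L..L})"
    by (intro card_inj_on_le) (auto intro: finite_PiE)
  also have "\<dots> = nat (2 * L + 1) ^ DIM('e)"
    by (simp add: card_PiE)
  finally have "real (card P) \<le> real (nat (2 * L + 1)) ^ DIM('e)"
    by (metis of_nat_le_iff of_nat_power)
  also have "\<dots> \<le> (2 * R * DIM('e) / \<delta> + 3) ^ DIM('e)"
  proof (rule power_mono)
    have "real_of_int L \<le> R * s + 1" unfolding L_def by linarith
    then show "real (nat (2 * L + 1)) \<le> 2 * R * DIM('e) / \<delta> + 3"
      using L by (simp add: s_def)
  qed simp
  finally show ?thesis .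
qed

text \<open>
  The box dimension is at most \<open>k\<close>, with explicit constant: an \<open>\<epsilon>\<close>-separated set has at most
  \<open>a * \<epsilon> ^ - k\<close> points. Separation is only asked of finite sets, and \<open>\<epsilon> \<le> 1\<close> lets additive constants be
  absorbed into \<open>a\<close>.
\<close>

definition packing_bound :: "('x \<Rightarrow> 'x \<Rightarrow> ennreal) \<Rightarrow> nat \<Rightarrow> 'x set \<Rightarrow> real \<Rightarrow> bool" where
  "packing_bound d k Z a \<longleftrightarrow> (\<forall>\<epsilon> P. 0 < \<epsilon> \<longrightarrow> \<epsilon> \<le> 1 \<longrightarrow> finite P \<longrightarrow> P \<subseteq> Z \<longrightarrow>
     (\<forall>x\<in>P. \<forall>y\<in>P. x \<noteq> y \<longrightarrow> ennreal \<epsilon> \<le> d x y) \<longrightarrow> real (card P) \<le> a * (1 / \<epsilon>) ^ k)"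

text \<open>
  Coordinates which expand distances, up to the factor \<open>1 / C\<close>, carry separated sets to separated
  sets of a Euclidean ball, where the grid count applies.
\<close>

lemma packing_bound_pullback:
  fixes h :: "'x \<Rightarrow> 'e::euclidean_space"
  assumes "C > 0" "R \<ge> 0" and R: "\<And>x. x \<in> W \<Longrightarrow> norm (h x) \<le> R"
    and C: "\<And>x y. x \<in> W \<Longrightarrow> y \<in> W \<Longrightarrow> d x y \<le> ennreal (C * norm (h x - h y))"
  shows "packing_bound d DIM('e) W ((2 * R * DIM('e) * C + 3) ^ DIM('e))"
  unfolding packing_bound_def
proof (intro allI impI)
  fix \<epsilon> :: real and P
  assume \<epsilon>: "0 < \<epsilon>" "\<epsilon> \<le> 1" and P: "finite P" "P \<subseteq> W"
    and sep: "\<forall>x\<in>P. \<forall>y\<in>P. x \<noteq> y \<longrightarrow> ennreal \<epsilon> \<le> d x y"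
  have "\<epsilon> / C \<le> norm (h x - h y)" if xy: "x \<in> P" "y \<in> P" "x \<noteq> y" for x y
  proof -
    have "ennreal \<epsilon> \<le> d x y" using sep xy by blast
    also have "\<dots> \<le> ennreal (C * norm (h x - h y))" using xy P(2) by (intro C) auto
    finally have "\<epsilon> \<le> C * norm (h x - h y)"
      using assms(1) by (subst (asm) ennreal_le_iff) auto
    then show ?thesis using assms(1) by (simp add: field_simps)
  qed
  then have "real (card P) \<le> (2 * R * DIM('e) / (\<epsilon> / C) + 3) ^ DIM('e)"
    using P \<epsilon>(1) assms(1,2) R by (intro card_separated_le[where h = h]) auto
  also have "\<dots> \<le> ((2 * R * DIM('e) * C + 3) * (1 / \<epsilon>)) ^ DIM('e)"
    using \<epsilon> assms(1,2) by (intro power_mono) (auto simp: field_simps)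
  finally show "real (card P) \<le> (2 * R * DIM('e) * C + 3) ^ DIM('e) * (1 / \<epsilon>) ^ DIM('e)"
    by (simp only: power_mult_distrib)
qed

text \<open>
  In a finite cover, a separated set is the union of its parts in the members of the cover, and
  these parts are separated too; so the constants add up.
\<close>

lemma packing_bound_compact:
  assumes "compact Z" and loc: "\<And>p. \<exists>W a. open W \<and> p \<in> W \<and> packing_bound d k W a"
  shows "\<exists>a. packing_bound d k Z a"
proof -
  obtain W a where W: "\<And>p. open (W p)" "\<And>p. p \<in> W p" "\<And>p. packing_bound d k (W p) (a p)"
    using loc by metis
  have "Z \<subseteq> (\<Union>p\<in>Z. W p)" using W(2) by blast
  then obtain I where "I \<subseteq> Z" and I: "finite I" "Z \<subseteq> (\<Union>p\<in>I. W p)"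
    using compactE_image[OF assms(1), of Z W] W(1) by metis
  have "packing_bound d k Z (\<Sum>p\<in>I. a p)"
    unfolding packing_bound_def
  proof (intro allI impI)
    fix \<epsilon> :: real and P
    assume \<epsilon>: "0 < \<epsilon>" "\<epsilon> \<le> 1" and P: "finite P" "P \<subseteq> Z"
      and sep: "\<forall>x\<in>P. \<forall>y\<in>P. x \<noteq> y \<longrightarrow> ennreal \<epsilon> \<le> d x y"
    have bound: "real (card (P \<inter> W p)) \<le> a p * (1 / \<epsilon>) ^ k" for p
    proof (rule W(3)[unfolded packing_bound_def, rule_format, OF \<epsilon>])
      show "ennreal \<epsilon> \<le> d x y" if "x \<in> P \<inter> W p" "y \<in> P \<inter> W p" "x \<noteq> y" for x y
        using sep that by blast
    qed (use P(1) in auto)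
    have "P = (\<Union>p\<in>I. P \<inter> W p)" using P(2) I(2) by blast
    then have "card P \<le> (\<Sum>p\<in>I. card (P \<inter> W p))"
      using card_UN_le[OF I(1), of "\<lambda>p. P \<inter> W p"] by simp
    then have "real (card P) \<le> (\<Sum>p\<in>I. real (card (P \<inter> W p)))"
      by (metis of_nat_le_iff of_nat_sum)
    also have "\<dots> \<le> (\<Sum>p\<in>I. a p * (1 / \<epsilon>) ^ k)"
      by (intro sum_mono bound)
    also have "\<dots> = (\<Sum>p\<in>I. a p) * (1 / \<epsilon>) ^ k"
      by (simp add: sum_distrib_right)
    finally show "real (card P) \<le> (\<Sum>p\<in>I. a p) * (1 / \<epsilon>) ^ k" .
  qed
  then show ?thesis ..
qed

section \<open>Riemannian distance in coordinates\<close>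

text \<open>
  \<open>Cr_on\<close> provides local extensions only. On an open set these agree with the function near each
  point, so its own derivative exists and varies continuously.
\<close>

lemma Cr_on_open_imp_C1:
  assumes "Cr_on r S f" "r \<ge> 1" "open S"
  shows "\<And>z. z \<in> S \<Longrightarrow> (f has_derivative frechet_derivative f (at z)) (at z)"
    and "continuous_on S (\<lambda>z. frechet_derivative f (at z) v)"
proof -
  have *: "\<exists>W D. open W \<and> z \<in> W \<and> (\<forall>y\<in>W. (f has_derivative D y) (at y)) \<and>
      (\<forall>v. continuous_on W (\<lambda>y. D y v))" if z: "z \<in> S" for z
  proof -
    have "enat 1 \<le> r" using assms(2) by (simp add: one_enat_def)
    then obtain W F where W: "open W" "z \<in> W" "Ck_open 1 W F" "\<forall>y\<in>S \<inter> W. F y = f y"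
      using assms(1) z unfolding Cr_on_def by blast
    then obtain D where D: "\<forall>y\<in>W. (F has_derivative D y) (at y)" "\<forall>v. continuous_on W (\<lambda>y. D y v)"
      by auto
    have "(f has_derivative D y) (at y)" if "y \<in> S \<inter> W" for y
    proof (rule has_derivative_transform_within_open)
      show "(F has_derivative D y) (at y)" using D(1) that by blast
      show "open (S \<inter> W)" using assms(3) W(1) by blast
      show "F x = f x" if "x \<in> S \<inter> W" for x using W(4) that by blast
    qed (rule that)
    moreover have "continuous_on (S \<inter> W) (\<lambda>y. D y v)" for v
      using D(2) by (meson continuous_on_subset inf_le2)
    moreover have "open (S \<inter> W)" "z \<in> S \<inter> W" using W z assms(3) by auto
    ultimately show ?thesis by blast
  qed
  show der: "(f has_derivative frechet_derivative f (at z)) (at z)" if "z \<in> S" for z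
    using *[OF that] by (metis frechet_derivative_at)
  show "continuous_on S (\<lambda>z. frechet_derivative f (at z) v)"
  proof (rule continuous_at_imp_continuous_on, rule ballI)
    fix z assume "z \<in> S"
    from *[OF this] obtain W D where W: "open W" "z \<in> W"
      and D: "\<forall>y\<in>W. (f has_derivative D y) (at y)" "continuous_on W (\<lambda>y. D y v)"
      by blast
    have "continuous_on W (\<lambda>z. frechet_derivative f (at z) v)"
      using D(2) by (rule continuous_on_eq) (use D(1) in \<open>metis frechet_derivative_at\<close>)
    with W show "isCont (\<lambda>z. frechet_derivative f (at z) v) z"
      by (simp add: continuous_on_eq_continuous_at)
  qed
qed


text \<open>
  By bilinearity the metric tensor is controlled by its finitely many components in the standard
  basis, each of which is continuous and so bounded on a compact set.
\<close>

lemma riemannian_metric_bound: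
  fixes \<A> :: "('x::{t2_space, second_countable_topology}, 'e::euclidean_space) mchart set"
  assumes g: "riemannian_metric \<A> g" and c: "c \<in> \<A>" "topological_chart c"
    and K: "compact K" "K \<subseteq> snd c ` fst c"
  shows "\<exists>C\<ge>0. \<forall>z\<in>K. \<forall>v. g c (inv_into (fst c) (snd c) z) v v \<le> C * (norm v)\<^sup>2"
proof -
  let ?\<psi> = "inv_into (fst c) (snd c)" and ?Z = "snd c ` fst c"
  have opn: "open ?Z" using c(2) by (simp add: topological_chart_def)
  have "\<exists>b. \<forall>z\<in>K. \<bar>g c (?\<psi> z) i j\<bar> \<le> b" for i j
  proof -
    have "Cr_on \<infinity> ?Z (\<lambda>z. g c (?\<psi> z) i j)"
      using g c(1) unfolding riemannian_metric_def by blast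
    from Cr_on_open_imp_C1(1)[OF this _ opn]
    have "continuous_on ?Z (\<lambda>z. g c (?\<psi> z) i j)"
      by (intro continuous_at_imp_continuous_on) (auto intro: has_derivative_continuous)
    then have "compact ((\<lambda>z. g c (?\<psi> z) i j) ` K)"
      using K by (intro compact_continuous_image) (auto intro: continuous_on_subset)
    then obtain b where "\<forall>x\<in>(\<lambda>z. g c (?\<psi> z) i j) ` K. norm x \<le> b"
      using compact_imp_bounded bounded_iff by metis
    then show ?thesis by auto
  qed
  then obtain b where b: "\<And>i j z. z \<in> K \<Longrightarrow> \<bar>g c (?\<psi> z) i j\<bar> \<le> b i j" by metis
  define C where "C = (\<Sum>(i,j)\<in>(Basis::'e set) \<times> Basis. \<bar>b i j\<bar>)"
  have "g c (?\<psi> z) v v \<le> C * (norm v)\<^sup>2" if z: "z \<in> K" for z v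
  proof -
    have "?\<psi> z \<in> fst c" using z K(2) by (meson inv_into_into subsetD)
    then have bil: "bilinear (g c (?\<psi> z))" using g c(1) unfolding riemannian_metric_def by blast
    have "g c (?\<psi> z) v v = g c (?\<psi> z) (\<Sum>i\<in>Basis. (v \<bullet> i) *\<^sub>R i) (\<Sum>i\<in>Basis. (v \<bullet> i) *\<^sub>R i)"
      by (simp add: euclidean_representation)
    also have "\<dots> = (\<Sum>(i,j)\<in>Basis \<times> Basis. g c (?\<psi> z) ((v \<bullet> i) *\<^sub>R i) ((v \<bullet> j) *\<^sub>R j))"
      by (rule bilinear_sum[OF bil])
    also have "\<dots> = (\<Sum>(i,j)\<in>Basis \<times> Basis. (v \<bullet> i) * (v \<bullet> j) * g c (?\<psi> z) i j)"
      by (intro sum.cong) (auto simp: bilinear_lmul[OF bil] bilinear_rmul[OF bil])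
    also have "\<dots> \<le> (\<Sum>(i,j)\<in>Basis \<times> Basis. \<bar>b i j\<bar> * (norm v)\<^sup>2)"
    proof (intro sum_mono, clarify)
      fix i j :: 'e assume ij: "i \<in> Basis" "j \<in> Basis"
      have "(v \<bullet> i) * (v \<bullet> j) * g c (?\<psi> z) i j \<le> \<bar>(v \<bullet> i)\<bar> * \<bar>(v \<bullet> j)\<bar> * \<bar>g c (?\<psi> z) i j\<bar>"
        by (metis abs_ge_self abs_mult)
      also have "\<dots> \<le> norm v * norm v * \<bar>b i j\<bar>"
        using ij b[OF z, of i j] by (intro mult_mono) (auto intro: Basis_le_norm)
      finally show "(v \<bullet> i) * (v \<bullet> j) * g c (?\<psi> z) i j \<le> \<bar>b i j\<bar> * (norm v)\<^sup>2"
        by (simp add: power2_eq_square mult_ac)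
    qed
    also have "\<dots> = C * (norm v)\<^sup>2"
      by (simp add: C_def sum_distrib_right case_prod_unfold)
    finally show ?thesis .
  qed
  moreover have "C \<ge> 0" unfolding C_def by (intro sum_nonneg) auto
  ultimately show ?thesis by blast
qed

text \<open>
  The distance is an infimum over curves, so it is bounded by the length of the curve which is the
  straight segment in the coordinates of \<open>c\<close>. The speed may be computed in any other chart, but
  the transformation rule of the metric tensor brings it back to the chart \<open>c\<close>, where the velocity is
  the constant vector \<open>v\<close>.
\<close>

lemma riemannian_dist_le_coordinate_segment:
  fixes \<A> :: "('x::{t2_space, second_countable_topology}, 'e::euclidean_space) mchart set"
  assumes M: "smooth_manifold \<A>" and g: "riemannian_metric \<A> g" and c: "c \<in> \<A>"
    and U: "open U" "convex U" "U \<subseteq> snd c ` fst c"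
    and C: "C \<ge> 0" "\<And>z v. z \<in> U \<Longrightarrow> g c (inv_into (fst c) (snd c) z) v v \<le> C * (norm v)\<^sup>2"
    and x: "x \<in> fst c" "snd c x \<in> U" and y: "y \<in> fst c" "snd c y \<in> U"
  shows "riemannian_dist \<A> g x y \<le> ennreal (sqrt C * norm (snd c y - snd c x))"
proof -
  let ?\<psi> = "inv_into (fst c) (snd c)"
  define v where "v = snd c y - snd c x"
  define line where "line s = snd c x + s *\<^sub>R v" for s
  define \<gamma> where "\<gamma> s = ?\<psi> (line s)" for s
  have chart: "topological_chart d" if "d \<in> \<A>" for d
    using M that by (simp add: smooth_manifold_def)
  obtain \<psi> where \<psi>: "homeomorphism (fst c) (snd c ` fst c) (snd c) \<psi>"
    using chart[OF c] by (auto simp: topological_chart_def)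
  have inj: "inj_on (snd c) (fst c)"
    by (rule inj_on_inverseI) (rule homeomorphism_apply1[OF \<psi>])
  have \<psi>_eq: "\<psi> z = ?\<psi> z" if z: "z \<in> snd c ` fst c" for z
  proof -
    obtain p where p: "p \<in> fst c" "z = snd c p" using z by blast
    then show ?thesis
      using homeomorphism_apply1[OF \<psi> p(1)] inv_into_f_f[OF inj p(1)] by simp
  qed
  have cont\<psi>: "continuous_on (snd c ` fst c) ?\<psi>"
    using homeomorphism_cont2[OF \<psi>] by (rule continuous_on_eq) (rule \<psi>_eq)
  have line_cont: "continuous_on S line" for S
    unfolding line_def by (intro continuous_intros)
  have line_der: "(line has_vector_derivative v) (at s)" for s
    unfolding line_def by (auto intro!: derivative_eq_intros)
  have line_U: "line s \<in> U" if "s \<in> {0..1}" for s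
  proof -
    have "line s = (1 - s) *\<^sub>R snd c x + s *\<^sub>R snd c y"
      by (simp add: line_def v_def algebra_simps)
    then show ?thesis using convexD_alt[OF U(2) x(2) y(2), of s] that by simp
  qed
  have \<gamma>_c: "\<gamma> s \<in> fst c" "snd c (\<gamma> s) = line s" if "s \<in> {0..1}" for s
    using line_U[OF that] U(3) unfolding \<gamma>_def by (auto intro: inv_into_into f_inv_into_f)
  have \<gamma>_cont: "continuous_on {0..1} \<gamma>"
    unfolding \<gamma>_def
    by (rule continuous_on_compose2[OF cont\<psi> line_cont]) (use line_U U(3) in auto)
  \<comment> \<open>The velocity of the segment in the chart d, and the domain of the change of coordinates to d.\<close>
  define D where "D d s = frechet_derivative (transition c d) (at (line s)) v" for d :: "('x, 'e) mchart" and s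
  define Z where "Z d = snd c ` (fst c \<inter> fst d)" for d :: "('x, 'e) mchart"
  have Z: "open (Z d)" "Cr_on \<infinity> (Z d) (transition c d)" if "d \<in> \<A>" for d
  proof -
    have "openin (top_of_set (fst c)) (fst c \<inter> fst d)"
      using chart[OF that] by (auto simp: topological_chart_def intro: openin_open_Int)
    then have "openin (top_of_set (snd c ` fst c)) (Z d)"
      unfolding Z_def by (rule homeomorphism_imp_open_map[OF \<psi>])
    then show "open (Z d)"
      using chart[OF c] by (auto simp: topological_chart_def intro: openin_open_trans)
    show "Cr_on \<infinity> (Z d) (transition c d)"
      using M c that by (auto simp: smooth_manifold_def Cr_compatible_def Z_def)
  qed
  have line_Z: "line s \<in> Z d" if "s \<in> {0..1}" "\<gamma> s \<in> fst d" for s d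
    using \<gamma>_c[OF that(1)] that(2) unfolding Z_def by (metis IntI imageI)
  \<comment> \<open>The derivative at the end points is two-sided; it exists because line is defined on all of the
     real line and stays in the open set Z d for parameters near s.\<close>
  have coord_der: "((snd d \<circ> \<gamma>) has_vector_derivative D d s) (at s)"
    if d: "d \<in> \<A>" and s: "s \<in> {0..1}" "\<gamma> s \<in> fst d" for d s
  proof -
    have "((transition c d \<circ> line) has_vector_derivative D d s) (at s)"
    proof -
      have "(transition c d has_derivative frechet_derivative (transition c d) (at (line s))) (at (line s))"
        using Cr_on_open_imp_C1(1)[OF Z(2)[OF d] _ Z(1)[OF d] line_Z[OF s]] by simp
      then show ?thesis
        unfolding D_def by (rule vector_derivative_diff_chain_within[OF line_der has_derivative_at_withinI])
    qed
    moreover have "open (line -` Z d)" using Z(1)[OF d] line_cont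
      by (simp add: open_vimage)
    moreover have "(transition c d \<circ> line) s' = (snd d \<circ> \<gamma>) s'" if s': "s' \<in> line -` Z d" for s'
    proof -
      obtain p where p: "p \<in> fst c \<inter> fst d" "line s' = snd c p"
        using s' by (auto simp: Z_def)
      have "inv_into (fst c \<inter> fst d) (snd c) (snd c p) = p"
        by (rule inv_into_f_f[OF _ p(1)]) (meson inf_le1 inj inj_on_subset)
      moreover have "inv_into (fst c) (snd c) (snd c p) = p"
        by (rule inv_into_f_f[OF inj]) (use p in blast)
      ultimately show ?thesis by (simp add: transition_def \<gamma>_def p(2))
    qed
    ultimately show ?thesis
      using line_Z[OF s] by (meson has_vector_derivative_transform_within_open vimageI2)
  qed
  have "piecewise_C1_curve \<A> \<gamma>"
    unfolding piecewise_C1_curve_def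
  proof (intro conjI ballI allI impI)
    fix d a b
    assume d: "d \<in> \<A>" and ab: "0 \<le> a" "b \<le> (1::real)" "\<gamma> ` {a..b} \<subseteq> fst d"
    have in_d: "s \<in> {0..1}" "\<gamma> s \<in> fst d" if "s \<in> {a..b}" for s using that ab by auto
    have "continuous_on {a..b} (D d)"
      unfolding D_def
    proof (rule continuous_on_compose2[OF _ line_cont])
      show "continuous_on (Z d) (\<lambda>z. frechet_derivative (transition c d) (at z) v)"
        by (rule Cr_on_open_imp_C1(2)[OF Z(2)[OF d] _ Z(1)[OF d]]) simp
      show "line ` {a..b} \<subseteq> Z d" using in_d line_Z by blast
    qed
    then have "(snd d \<circ> \<gamma>) C1_differentiable_on {a..b}"
      unfolding C1_differentiable_on_def using coord_der[OF d in_d] by blast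
    then show "(snd d \<circ> \<gamma>) piecewise_C1_differentiable_on {a..b}"
      by (rule C1_differentiable_imp_piecewise)
  qed (rule \<gamma>_cont)
  moreover have "\<gamma> 0 = x" "\<gamma> 1 = y"
    using inj x y by (simp_all add: \<gamma>_def line_def v_def)
  ultimately have "riemannian_dist \<A> g x y \<le> curve_length \<A> g \<gamma>"
    unfolding riemannian_dist_def by (intro Inf_lower) blast
  also have "\<dots> \<le> (\<integral>\<^sup>+ s. ennreal (sqrt C * norm v) * indicator {0..1::real} s \<partial>lborel)"
    unfolding curve_length_def
  proof (rule nn_integral_mono)
    fix s :: real
    show "ennreal (speed \<A> g \<gamma> s) * indicator {0..1} s \<le> ennreal (sqrt C * norm v) * indicator {0..1} s"
    proof (cases "s \<in> {0..1}")
      case True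
      \<comment> \<open>The chart in which the definition of the speed evaluates the metric tensor at this parameter.\<close>
      define d where "d = (SOME d. d \<in> \<A> \<and> \<gamma> s \<in> fst d)"
      have d: "d \<in> \<A>" "\<gamma> s \<in> fst d"
        using someI[of "\<lambda>d. d \<in> \<A> \<and> \<gamma> s \<in> fst d", OF conjI, OF c \<gamma>_c(1)[OF True]]
        unfolding d_def by auto
      have "vector_derivative (snd d \<circ> \<gamma>) (at s) = D d s"
        using coord_der[OF d(1) True d(2)] by (rule vector_derivative_at)
      then have "speed \<A> g \<gamma> s = sqrt (g d (\<gamma> s) (D d s) (D d s))"
        by (simp add: speed_def Let_def flip: d_def)
      also have "g d (\<gamma> s) (D d s) (D d s) = g c (\<gamma> s) v v"
      proof -
        have "\<forall>v w. (let D = frechet_derivative (transition c d) (at (snd c (\<gamma> s)))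
            in g c (\<gamma> s) v w = g d (\<gamma> s) (D v) (D w))"
          using g c d \<gamma>_c(1)[OF True] unfolding riemannian_metric_def by blast
        then show ?thesis by (simp add: Let_def D_def \<gamma>_c(2)[OF True])
      qed
      also have "sqrt (g c (\<gamma> s) v v) \<le> sqrt (C * (norm v)\<^sup>2)"
        using C(2)[OF line_U[OF True], of v] by (simp add: \<gamma>_def)
      also have "\<dots> = sqrt C * norm v" by (simp add: real_sqrt_mult)
      finally show ?thesis by (intro mult_right_mono ennreal_leI) auto
    qed simp
  qed
  also have "\<dots> = ennreal (sqrt C * norm v)"
    by (subst nn_integral_cmult_indicator) auto
  finally show ?thesis by (simp add: v_def)
qed

lemma riemannian_packing_bound_local:
  fixes \<A> :: "('x::{t2_space, second_countable_topology}, 'e::euclidean_space) mchart set"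
  assumes M: "smooth_manifold \<A>" and g: "riemannian_metric \<A> g"
  shows "\<exists>W a. open W \<and> p \<in> W \<and> packing_bound (riemannian_dist \<A> g) DIM('e) W a"
proof -
  obtain c where c: "c \<in> \<A>" "p \<in> fst c" using M unfolding smooth_manifold_def by blast
  have chart: "topological_chart c" using M c by (simp add: smooth_manifold_def)
  then have opn: "open (fst c)" "open (snd c ` fst c)" and cont: "continuous_on (fst c) (snd c)"
    by (auto simp: topological_chart_def homeomorphism_def)
  obtain e where e: "e > 0" "cball (snd c p) e \<subseteq> snd c ` fst c"
    using opn(2) c(2) by (meson imageI open_contains_cball)
  obtain C where C: "C \<ge> 0"
    "\<And>z v. z \<in> cball (snd c p) e \<Longrightarrow> g c (inv_into (fst c) (snd c) z) v v \<le> C * (norm v)\<^sup>2"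
    using riemannian_metric_bound[OF g c(1) chart compact_cball e(2)] by metis
  define W where "W = fst c \<inter> snd c -` ball (snd c p) e"
  have "norm (snd c x) \<le> norm (snd c p) + e" if "x \<in> W" for x
  proof -
    have "norm (snd c p - snd c x) < e" using that by (simp add: W_def dist_norm)
    then show ?thesis using norm_triangle_ineq2[of "snd c x" "snd c p"] by (simp add: norm_minus_commute)
  qed
  \<comment> \<open>The summand 1 makes the constant positive also if C = 0.\<close>
  moreover have "riemannian_dist \<A> g x y \<le> ennreal ((sqrt C + 1) * norm (snd c x - snd c y))"
    if "x \<in> W" "y \<in> W" for x y
  proof -
    have "riemannian_dist \<A> g x y \<le> ennreal (sqrt C * norm (snd c y - snd c x))"
      by (rule riemannian_dist_le_coordinate_segment[OF M g c(1) open_ball convex_ball _ C(1),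
            of "snd c p" e]) (use e that C(2) in \<open>auto simp: W_def\<close>)
    also have "\<dots> \<le> ennreal ((sqrt C + 1) * norm (snd c x - snd c y))"
      by (intro ennreal_leI) (simp add: norm_minus_commute algebra_simps)
    finally show ?thesis .
  qed
  moreover have "sqrt C + 1 > 0" "norm (snd c p) + e \<ge> 0" using C(1) e(1) by (auto simp: add_nonneg_pos)
  ultimately have "packing_bound (riemannian_dist \<A> g) DIM('e) W
      ((2 * (norm (snd c p) + e) * DIM('e) * (sqrt C + 1) + 3) ^ DIM('e))"
    by (intro packing_bound_pullback[where h = "snd c"])
  moreover have "open W" unfolding W_def
    by (rule continuous_open_preimage[OF cont opn(1)]) simp
  moreover have "p \<in> W" using c e by (simp add: W_def)
  ultimately show ?thesis by blast
qed

section \<open>Comparison of the growth rates\<close>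

lemma double_exponential_beats_exponential:
  fixes a k :: real and d :: nat
  shows "\<exists>m::nat. a * (k * exp (real m)) ^ d < real (2 ^ 2 ^ m - 1)"
proof -
  \<comment> \<open>Positive majorants of the coefficient and of the rate, so that the asymptotics have known signs.\<close>
  define c where "c = \<bar>a * k ^ d\<bar> + 1"
  define e where "e = real d + 1"
  have "c > 0" "e > 0" by (auto simp: c_def e_def)
  then have "eventually (\<lambda>m::nat. c * exp (e * real m) < 2 powr (2 powr real m) - 1) at_top"
    by real_asymp
  then obtain m :: nat where m: "c * exp (e * real m) < 2 powr (2 powr real m) - 1"
    by (auto simp: eventually_at_top_linorder)
  have "a * (k * exp (real m)) ^ d = a * k ^ d * exp (d * real m)"
    by (simp add: power_mult_distrib exp_of_nat_mult)
  also have "\<dots> \<le> c * exp (e * real m)"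
    unfolding c_def e_def by (intro mult_mono) (auto simp: mult_right_mono)
  also note m
  also have "2 powr (2 powr real m) - 1 = real (2 ^ 2 ^ m - 1)"
  proof -
    have "2 powr real m = real (2 ^ m)" by (simp add: powr_realpow)
    then have "2 powr (2 powr real m) = (2::real) ^ 2 ^ m"
      using powr_realpow[of 2 "2 ^ m"] by simp
    then show ?thesis by (simp add: of_nat_diff)
  qed
  finally show ?thesis by blast
qed

theorem proposition1p3:
  fixes n q :: nat and r :: enat
    and A :: "('m::metric_space, real^2, 'm) fchart set"
    and t :: "cgraph \<Rightarrow> 'm"
    and \<A> :: "('x::{t2_space, second_countable_topology}, 'e::euclidean_space) mchart set"
    and g :: "('x, 'e) mchart \<Rightarrow> 'x \<Rightarrow> 'e \<Rightarrow> 'e \<Rightarrow> real"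
    and B :: "'e set"
    and \<F> :: "('x, 'e) mchart set"
  assumes "n \<ge> 2"
    and "is_suspension n A t"
    and "r \<ge> 1"
    and "smooth_manifold \<A>"
    and "riemannian_metric \<A> g"
    and "Cinf_r_foliation r \<A> B \<F>" and "card B = q"
  shows "\<not> (\<exists>\<phi> :: 'm \<Rightarrow> 'x. foliated_embedding A (foliated_charts B \<F>) \<phi> \<and>
            bi_lipschitz (riemannian_dist \<A> g) \<phi>)"
proof
  assume "\<exists>\<phi> :: 'm \<Rightarrow> 'x. foliated_embedding A (foliated_charts B \<F>) \<phi> \<and>
            bi_lipschitz (riemannian_dist \<A> g) \<phi>"
  then obtain \<phi> :: "'m \<Rightarrow> 'x" where emb: "foliated_embedding A (foliated_charts B \<F>) \<phi>"
    and lip: "bi_lipschitz (riemannian_dist \<A> g) \<phi>"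
    by blast
  let ?d = "riemannian_dist \<A> g"
  obtain K where K: "K > 0" "\<And>x y. ennreal (1 / K * dist x y) \<le> ?d (\<phi> x) (\<phi> y)"
    using lip unfolding bi_lipschitz_def by blast
  obtain K' where K': "K' > 0"
    "\<And>T T'. T \<in> pointed_trees n \<Longrightarrow> T' \<in> pointed_trees n \<Longrightarrow>
       1 / K' * tree_dist n T T' \<le> dist (t T) (t T')"
    using assms(2) unfolding is_suspension_def by blast
  have "compact (range \<phi>)"
    using assms(2) emb unfolding is_suspension_def foliated_embedding_def
    by (meson compact_continuous_image homeomorphism_cont1)
  then obtain a where a: "packing_bound ?d DIM('e) (range \<phi>) a"
    using packing_bound_compact riemannian_packing_bound_local[OF assms(4,5)] by blast
  \<comment> \<open>The constant K * K' is what the two bi-Lipschitz maps lose; the maximum ensures \<epsilon> \<le> 1 below.\<close>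
  define k where "k = max 1 (K * K')"
  have k: "k \<ge> 1" "K * K' \<le> k" by (auto simp: k_def)
  obtain m :: nat where m: "a * (k * exp (real m)) ^ DIM('e) < real (2 ^ 2 ^ m - 1)"
    using double_exponential_beats_exponential by blast
  define \<epsilon> where "\<epsilon> = exp (- real m) / k"
  have \<epsilon>: "0 < \<epsilon>" "\<epsilon> \<le> 1" "1 / \<epsilon> = k * exp (real m)"
    using k(1) order_trans[of "exp (- real m)" 1 k] by (auto simp: \<epsilon>_def exp_minus field_simps)
  obtain X where X: "X \<subseteq> pointed_trees n" "finite X" "card X = 2 ^ 2 ^ m - 1"
    and sep: "\<And>T T'. T \<in> X \<Longrightarrow> T' \<in> X \<Longrightarrow> T \<noteq> T' \<Longrightarrow>
      tree_dist n T T' \<ge> exp (- real m) \<or> tree_dist n T' T \<ge> exp (- real m)"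
    using separated_trees[OF assms(1), of m] by blast
  have dist_ge: "dist (t T) (t T') \<ge> K * \<epsilon>" if T: "T \<in> X" "T' \<in> X" "T \<noteq> T'" for T T'
  proof -
    have "dist (t T) (t T') \<ge> exp (- real m) / K'"
    proof -
      have *: "1 / K' * tree_dist n S S' \<le> dist (t T) (t T')" if "S = T \<and> S' = T' \<or> S = T' \<and> S' = T" for S S'
      proof -
        have "S \<in> pointed_trees n" "S' \<in> pointed_trees n" using that T X(1) by blast+
        then have "1 / K' * tree_dist n S S' \<le> dist (t S) (t S')" by (rule K'(2))
        then show ?thesis using that by (metis dist_commute)
      qed
      have "exp (- real m) / K' \<le> 1 / K' * tree_dist n T T' \<or> exp (- real m) / K' \<le> 1 / K' * tree_dist n T' T"
        using sep[OF T] K'(1) by (auto simp: divide_right_mono)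
      with *[of T T'] *[of T' T] show ?thesis by auto
    qed
    moreover have "K * \<epsilon> \<le> exp (- real m) / K'"
      using K(1) K'(1) k by (simp add: \<epsilon>_def field_simps)
    ultimately show ?thesis by linarith
  qed
  let ?f = "\<lambda>T. \<phi> (t T)"
  have img: "ennreal \<epsilon> \<le> ?d (?f T) (?f T')" if "T \<in> X" "T' \<in> X" "T \<noteq> T'" for T T'
  proof -
    have "\<epsilon> \<le> 1 / K * dist (t T) (t T')"
      using dist_ge[OF that] K(1) by (simp add: field_simps)
    then show ?thesis using K(2) by (meson ennreal_leI order_trans)
  qed
  have "inj \<phi>"
    using emb unfolding foliated_embedding_def by (metis UNIV_I homeomorphism_apply1 injI)
  then have "inj_on ?f X"
    using dist_ge \<epsilon>(1) K(1) by (intro inj_onI) (metis dist_self injD mult_pos_pos not_le)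
  then have "card (?f ` X) = 2 ^ 2 ^ m - 1" using X(3) by (simp add: card_image)
  moreover have "real (card (?f ` X)) \<le> a * (1 / \<epsilon>) ^ DIM('e)"
  proof (rule a[unfolded packing_bound_def, rule_format, OF \<epsilon>(1,2)])
    fix p q assume "p \<in> ?f ` X" "q \<in> ?f ` X" "p \<noteq> q"
    then show "ennreal \<epsilon> \<le> ?d p q" using img by blast
  qed (use X(2) in auto)
  ultimately show False using m \<epsilon>(3) by simp
qed

end
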